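(* Let $N\ge1$ and let $R$ be an invertible charge-conserving operator on $V\otimes V$, $V=\mathbb C^N$, with entries $a_{ii},a_{ij},b_{ij},c_{ij},d_{ij}$ as in the context. Then $$(R\otimes 1_V)(1_V\otimes R)(R\otimes 1_V)=(1_V\otimes R)(R\otimes 1_V)(1_V\otimes R)$$ holds if and only if the following constraints hold, together with all their images under the action of the symmetric group $\Sigma_N$ by $\omega a_{ij}=a_{\omega(i)\omega(j)}$, and similarly for $b,c,d$ (i.e. with the indices $1,2$, respectively $1,2,3$, replaced by arbitrary pairwise distinct indices in $\{1,\dots,N\}$): $$a_{12}(a_{11}^2-a_{12}a_{11}-b_{12}c_{12})=0,\qquad a_{12}(a_{22}^2-a_{12}a_{22}-b_{12}c_{12})=0,$$ $$a_{12}c_{12}d_{12}=0=a_{12}b_{12}d_{12},\qquad a_{12}d_{12}(a_{12}-d_{12})=0,$$ $$c_{12}(d_{13}d_{23}-d_{12}d_{23}-a_{12}d_{13})=0,\qquad c_{12}(-a_{13}a_{23}+a_{12}a_{23}+d_{12}a_{13})=0,$$ $$-a_{13}d_{23}^2+a_{13}^2d_{23}-a_{12}b_{23}c_{23}+a_{12}b_{13}c_{13}=0.$$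
   Context: Let $V=\mathbb C^N$ have standard basis $e_1,\dots,e_N$ and write $|ij\rangle=e_i\otimes e_j$. A linear operator $R$ on $V\otimes V$ is charge-conserving if there are scalars with $R|ii\rangle=a_{ii}|ii\rangle$ for all $i$, and for all $i<j$: $R|ij\rangle=a_{ij}|ij\rangle+b_{ij}|ji\rangle$, $R|ji\rangle=c_{ij}|ij\rangle+d_{ij}|ji\rangle$. For $i<j$ one also sets $a_{ji}=d_{ij}$, $d_{ji}=a_{ij}$, $b_{ji}=c_{ij}$, $c_{ji}=b_{ij}$. (A strict monoidal functor $F$ from the braid category to charge-conserving matrices with $F(1)=1$ is the same thing as an invertible charge-conserving $R=F(\sigma)$ satisfying the displayed braid relation.) *)

theory Defs
  imports "HOL-Analysis.Analysis"
begin

text \<open>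
  The space \<open>V = \<complex>\<^sup>N\<close> is \<open>complex ^ 'n\<close>, where the finite linearly ordered type \<open>'n\<close> plays
  the role of \<open>{1 < \<dots> < N}\<close>. Then \<open>V \<otimes> V\<close> is \<open>complex ^ ('n \<times> 'n)\<close>, and a linear operator
  is identified with its matrix in the standard basis (rows first, acting by \<open>*v\<close>).
\<close>

definition tensor_vec ::
    "complex ^ 'a::finite \<Rightarrow> complex ^ 'b::finite \<Rightarrow> complex ^ ('a \<times> 'b)" where
  "tensor_vec u v = (\<chi> p. u $ fst p * v $ snd p)"

definition tensor_op ::
    "complex ^ 'a::finite ^ 'a \<Rightarrow> complex ^ 'b::finite ^ 'b \<Rightarrow> complex ^ ('a \<times> 'b) ^ ('a \<times> 'b)" where
  "tensor_op A B = (\<chi> p q. A $ fst p $ fst q * B $ snd p $ snd q)"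

text \<open>
  The canonical identification \<open>(V \<otimes> V) \<otimes> V = V \<otimes> (V \<otimes> V)\<close>, needed to compose
  \<open>R \<otimes> 1\<close> with \<open>1 \<otimes> R\<close>; recall that the product type associates to the right.
\<close>

definition reassoc_op ::
    "complex ^ (('a::finite \<times> 'b::finite) \<times> 'c::finite) ^ (('a \<times> 'b) \<times> 'c) \<Rightarrow>
     complex ^ ('a \<times> 'b \<times> 'c) ^ ('a \<times> 'b \<times> 'c)" where
  "reassoc_op A =
     (\<chi> p q. A $ ((fst p, fst (snd p)), snd (snd p)) $ ((fst q, fst (snd q)), snd (snd q)))"

definition ket :: "'n::finite \<Rightarrow> 'n \<Rightarrow> complex ^ ('n \<times> 'n)" where
  "ket i j = tensor_vec (axis i 1) (axis j 1)"

text \<open>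
  \<open>R\<close> is charge-conserving with entries \<open>a, b, c, d\<close>. The last clause is the convention extending
  the entries from \<open>i < j\<close> to all \<open>i \<noteq> j\<close>; the values of \<open>b, c, d\<close> at \<open>(i, i)\<close> play no role.
\<close>

definition charge_conserving_with ::
    "complex ^ ('n::{finite,linorder} \<times> 'n) ^ ('n \<times> 'n) \<Rightarrow>
     ('n \<Rightarrow> 'n \<Rightarrow> complex) \<Rightarrow> ('n \<Rightarrow> 'n \<Rightarrow> complex) \<Rightarrow>
     ('n \<Rightarrow> 'n \<Rightarrow> complex) \<Rightarrow> ('n \<Rightarrow> 'n \<Rightarrow> complex) \<Rightarrow> bool" where
  "charge_conserving_with R a b c d \<longleftrightarrow>
     (\<forall>i. R *v ket i i = a i i *s ket i i) \<and>
     (\<forall>i j. i < j \<longrightarrow>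
        R *v ket i j = a i j *s ket i j + b i j *s ket j i \<and>
        R *v ket j i = c i j *s ket i j + d i j *s ket j i) \<and>
     (\<forall>i j. i < j \<longrightarrow>
        a j i = d i j \<and> d j i = a i j \<and> b j i = c i j \<and> c j i = b i j)"

definition braid_relation :: "complex ^ ('n::finite \<times> 'n) ^ ('n \<times> 'n) \<Rightarrow> bool" where
  "braid_relation R \<longleftrightarrow>
     (let R1 = reassoc_op (tensor_op R (mat 1 :: complex ^ 'n ^ 'n));
          R2 = tensor_op (mat 1 :: complex ^ 'n ^ 'n) R
      in R1 ** R2 ** R1 = R2 ** R1 ** R2)"

end

theory Submission
  imports Defs
begin

text \<open>
  Put \<open>B\<^sub>i\<^sub>j = b\<^sub>i\<^sub>j\<close> for \<open>i \<noteq> j\<close> and \<open>B\<^sub>i\<^sub>i = 0\<close>. The ordering convention on the entries makes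
  \<open>R|ij\<rangle> = a\<^sub>i\<^sub>j|ij\<rangle> + B\<^sub>i\<^sub>j|ji\<rangle>\<close> valid for all \<open>i, j\<close>, equal or not. Expanding both sides of the
  braid relation on \<open>|ijk\<rangle>\<close>, all terms cancel except those at \<open>|ijk\<rangle>\<close>, \<open>|jik\<rangle>\<close> and \<open>|ikj\<rangle>\<close>;
  the second of these carries the factor \<open>B\<^sub>i\<^sub>j\<close> and the third \<open>B\<^sub>j\<^sub>k\<close>, so their coefficients vanish
  separately even when some of the indices coincide. This gives three scalar equations per triple,
  and the listed constraints are these equations sorted by which of \<open>i, j, k\<close> are equal.
\<close>

lemma ket_eq_axis: "ket i j = axis (i, j) 1"
  by (auto simp: ket_def tensor_vec_def axis_def vec_eq_iff)

lemma axis_nth_if: "axis i x $ j = (if j = i then x else 0)"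
  by (simp add: axis_def)

lemma matrix_vector_mult_axis_nth: "((A :: 'a::comm_semiring_1 ^ 'n ^ 'm) *v axis q 1) $ p = A $ p $ q"
  by (simp add: matrix_vector_mult_def axis_def if_distrib cong: if_cong)

lemma matrix_eq_iff_axis:
  fixes A B :: "'a::comm_semiring_1 ^ 'n ^ 'm"
  shows "A = B \<longleftrightarrow> (\<forall>q. A *v axis q 1 = B *v axis q 1)"
  by (auto simp: vec_eq_iff matrix_vector_mult_axis_nth)

text \<open>The identity factor fixes the first index, so only the column \<open>(j, k)\<close> of
  \<open>R\<close> enters. The case \<open>j = k\<close> is included: the two terms then merge on
  both sides.\<close>

lemma tensor_op_id_left_axis:
  assumes "R *v axis (j, k) 1 = x *s axis (j, k) 1 + y *s axis (k, j) 1"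
  shows "tensor_op (mat 1) R *v axis (i, j, k) 1 = x *s axis (i, j, k) 1 + y *s axis (i, k, j) 1"
proof -
  have R: "R $ p $ (j, k) = x * (if p = (j, k) then 1 else 0) + y * (if p = (k, j) then 1 else 0)" for p
    unfolding matrix_vector_mult_axis_nth [symmetric] assms by (simp add: axis_nth_if)
  have "(tensor_op (mat 1) R *v axis (i, j, k) 1) $ (l, p) =
    (x *s axis (i, j, k) 1 + y *s axis (i, k, j) 1) $ (l, p)" for l p
    by (cases "l = i") (simp_all add: R matrix_vector_mult_axis_nth axis_nth_if tensor_op_def mat_def)
  then show ?thesis
    by (simp add: vec_eq_iff)
qed

lemma tensor_op_id_right_axis:
  assumes "R *v axis (i, j) 1 = x *s axis (i, j) 1 + y *s axis (j, i) 1"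
  shows "reassoc_op (tensor_op R (mat 1)) *v axis (i, j, k) 1 =
    x *s axis (i, j, k) 1 + y *s axis (j, i, k) 1"
proof -
  have R: "R $ p $ (i, j) = x * (if p = (i, j) then 1 else 0) + y * (if p = (j, i) then 1 else 0)" for p
    unfolding matrix_vector_mult_axis_nth [symmetric] assms by (simp add: axis_nth_if)
  have "(reassoc_op (tensor_op R (mat 1)) *v axis (i, j, k) 1) $ (l, m, n) =
    (x *s axis (i, j, k) 1 + y *s axis (j, i, k) 1) $ (l, m, n)" for l m n
    by (cases "n = k")
      (simp_all add: R matrix_vector_mult_axis_nth axis_nth_if reassoc_op_def tensor_op_def mat_def)
  then show ?thesis
    by (simp add: vec_eq_iff)
qed

text \<open>With \<open>a\<close> and \<open>B\<close> uniform in the indices and no order on them,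
  one computation serves every triple. The three expressions are the coefficients of the difference
  of the two sides at \<open>(i, j, k)\<close>, \<open>(j, i, k)\<close> and
  \<open>(i, k, j)\<close>.\<close>

lemma braid_relation_iff_coefficients:
  fixes R :: "complex ^ ('n::finite \<times> 'n) ^ ('n \<times> 'n)"
  assumes R: "\<And>i j. R *v axis (i, j) 1 = a i j *s axis (i, j) 1 + B i j *s axis (j, i) 1"
    and B: "\<And>i. B i i = 0"
  shows "braid_relation R \<longleftrightarrow> (\<forall>i j k.
    (a i j)\<^sup>2 * a j k + a i k * B i j * B j i - a i j * (a j k)\<^sup>2 - a i k * B j k * B k j = 0 \<and>
    B i j * (a i j * a j k + a i k * a j i - a j k * a i k) = 0 \<and>
    B j k * (a i j * a i k - a j k * a i j - a i k * a k j) = 0)"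
proof -
  define R1 where "R1 = reassoc_op (tensor_op R (mat 1 :: complex ^ 'n ^ 'n))"
  define R2 where "R2 = tensor_op (mat 1 :: complex ^ 'n ^ 'n) R"
  define X where "X i j k = (a i j)\<^sup>2 * a j k + a i k * B i j * B j i
      - a i j * (a j k)\<^sup>2 - a i k * B j k * B k j" for i j k
  define Y where "Y i j k = B i j * (a i j * a j k + a i k * a j i - a j k * a i k)" for i j k
  define Z where "Z i j k = B j k * (a i j * a i k - a j k * a i j - a i k * a k j)" for i j k
  have R1: "R1 *v axis (i, j, k) 1 = a i j *s axis (i, j, k) 1 + B i j *s axis (j, i, k) 1" for i j k
    unfolding R1_def by (rule tensor_op_id_right_axis [OF R])
  have R2: "R2 *v axis (i, j, k) 1 = a j k *s axis (i, j, k) 1 + B j k *s axis (i, k, j) 1" for i j k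
    unfolding R2_def by (rule tensor_op_id_left_axis [OF R])
  have "braid_relation R \<longleftrightarrow> (\<forall>i j k.
      (R1 ** R2 ** R1) *v axis (i, j, k) 1 - (R2 ** R1 ** R2) *v axis (i, j, k) 1 = 0)"
    by (simp add: braid_relation_def R1_def R2_def Let_def matrix_eq_iff_axis)
  also have "\<dots> \<longleftrightarrow> (\<forall>i j k.
      X i j k *s axis (i, j, k) 1 + Y i j k *s axis (j, i, k) 1 + Z i j k *s axis (i, k, j) 1 = 0)"
  proof -
    have "(R1 ** R2 ** R1) *v axis (i, j, k) 1 - (R2 ** R1 ** R2) *v axis (i, j, k) 1 =
        X i j k *s axis (i, j, k) 1 + Y i j k *s axis (j, i, k) 1 + Z i j k *s axis (i, k, j) 1" for i j k
      unfolding matrix_vector_mul_assoc [symmetric] R1 R2 vec.add vec.scale X_def Y_def Z_def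
      \<comment> \<open>In each component the entries of the basis vectors act as indeterminates, so
        a single ring identity holds whichever indices coincide. The terms at
        \<open>(j, k, i)\<close>, \<open>(k, i, j)\<close> and \<open>(k, j, i)\<close>
        cancel.\<close>
      unfolding vec_eq_iff vector_add_component vector_minus_component vector_smult_component
      by (intro allI) algebra
    then show ?thesis by simp
  qed
  also have "\<dots> \<longleftrightarrow> (\<forall>i j k. X i j k = 0 \<and> Y i j k = 0 \<and> Z i j k = 0)"
  proof -
    have "X i j k *s axis (i, j, k) 1 + Y i j k *s axis (j, i, k) 1 + Z i j k *s axis (i, k, j) 1 = 0
        \<longleftrightarrow> X i j k = 0 \<and> Y i j k = 0 \<and> Z i j k = 0" (is "?v = 0 \<longleftrightarrow> _") for i j k
    proof
      assume "?v = 0"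
      then have v: "?v $ (i, j, k) = 0" "?v $ (j, i, k) = 0" "?v $ (i, k, j) = 0" by simp_all
      \<comment> \<open>Basis vectors can merge only if \<open>i = j\<close> or
        \<open>j = k\<close>, and then the vanishing diagonal of \<open>B\<close> removes the extra
        term. If \<open>i = k\<close> but \<open>j\<close> differs, the three are still
        distinct.\<close>
      have "Y i j k = 0" if "i = j" using that B by (simp add: Y_def)
      moreover have "Z i j k = 0" if "j = k" using that B by (simp add: Z_def)
      ultimately show "X i j k = 0 \<and> Y i j k = 0 \<and> Z i j k = 0"
        using v by (cases "i = j"; cases "j = k") (simp_all add: axis_nth_if)
    qed simp
    then show ?thesis by simp
  qed
  finally show ?thesis
    by (simp only: X_def Y_def Z_def)
qed

lemma forall_triple_iff_by_coincidence:
  "(\<forall>i j k. P i j k) \<longleftrightarrow> (\<forall>i. P i i i) \<and>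
    (\<forall>i j. i \<noteq> j \<longrightarrow> P i i j \<and> P i j j \<and> P i j i) \<and>
    (\<forall>i j k. i \<noteq> j \<and> i \<noteq> k \<and> j \<noteq> k \<longrightarrow> P i j k)"
  by metis

theorem theorem3p12:
  fixes R :: "complex ^ ('n::{finite,linorder} \<times> 'n) ^ ('n \<times> 'n)"
    and a b c d :: "'n \<Rightarrow> 'n \<Rightarrow> complex"
  assumes "invertible R"
    and "charge_conserving_with R a b c d"
  shows "braid_relation R \<longleftrightarrow>
    (\<forall>i j. i \<noteq> j \<longrightarrow>
       a i j * ((a i i)\<^sup>2 - a i j * a i i - b i j * c i j) = 0 \<and>
       a i j * ((a j j)\<^sup>2 - a i j * a j j - b i j * c i j) = 0 \<and>
       a i j * c i j * d i j = 0 \<and>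
       a i j * b i j * d i j = 0 \<and>
       a i j * d i j * (a i j - d i j) = 0) \<and>
    (\<forall>i j k. i \<noteq> j \<and> i \<noteq> k \<and> j \<noteq> k \<longrightarrow>
       c i j * (d i k * d j k - d i j * d j k - a i j * d i k) = 0 \<and>
       c i j * (- a i k * a j k + a i j * a j k + d i j * a i k) = 0 \<and>
       - a i k * (d j k)\<^sup>2 + (a i k)\<^sup>2 * d j k
         - a i j * b j k * c j k + a i j * b i k * c i k = 0)"
proof -
  define B where "B i j = (if i = j then 0 else b i j)" for i j
  have cc: "R *v ket i i = a i i *s ket i i"
    "i < j \<Longrightarrow> R *v ket i j = a i j *s ket i j + b i j *s ket j i"
    "i < j \<Longrightarrow> R *v ket j i = c i j *s ket i j + d i j *s ket j i"
    "i < j \<Longrightarrow> a j i = d i j" "i < j \<Longrightarrow> d j i = a i j"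
    "i < j \<Longrightarrow> b j i = c i j" "i < j \<Longrightarrow> c j i = b i j" for i j
    using assms(2) by (auto simp: charge_conserving_with_def)
  \<comment> \<open>This eliminates \<open>c\<close> and \<open>d\<close>, turning all constraints
    into polynomials in \<open>a\<close> and \<open>B\<close>.\<close>
  have d: "d i j = a j i" and c: "c i j = b j i" if "i \<noteq> j" for i j
    using that cc(4-7) by (metis linorder_neqE)+
  have "R *v axis (i, j) 1 = a i j *s axis (i, j) 1 + B i j *s axis (j, i) 1" for i j
  proof (cases i j rule: linorder_cases)
    case less
    then show ?thesis using cc(2) by (simp add: ket_eq_axis B_def)
  next
    case equal
    then show ?thesis using cc(1) by (simp add: ket_eq_axis B_def)
  next
    case greater
    then show ?thesis using cc(3) [OF greater] cc(4,6) by (simp add: ket_eq_axis B_def add.commute)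
  qed
  moreover define X where "X i j k = (a i j)\<^sup>2 * a j k + a i k * B i j * B j i
      - a i j * (a j k)\<^sup>2 - a i k * B j k * B k j" for i j k
  moreover define Y where "Y i j k = B i j * (a i j * a j k + a i k * a j i - a j k * a i k)" for i j k
  moreover define Z where "Z i j k = B j k * (a i j * a i k - a j k * a i j - a i k * a k j)" for i j k
  ultimately have "braid_relation R \<longleftrightarrow> (\<forall>i j k. X i j k = 0 \<and> Y i j k = 0 \<and> Z i j k = 0)"
    (is "_ \<longleftrightarrow> (\<forall>i j k. ?E i j k)")
    by (simp only: braid_relation_iff_coefficients [of R a B] B_def simp_thms if_True)
  also have "\<dots> \<longleftrightarrow>
    (\<forall>i j. i \<noteq> j \<longrightarrow> ?E i i j \<and> ?E i j j \<and> ?E i j i) \<and>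
    (\<forall>i j k. i \<noteq> j \<and> i \<noteq> k \<and> j \<noteq> k \<longrightarrow> ?E i j k)"
  proof -
    \<comment> \<open>Both cubic terms of \<open>X\<close> equal the cube of \<open>a i i\<close>,
      and all others carry a diagonal entry of \<open>B\<close>.\<close>
    have "?E i i i" for i
      by (simp add: X_def Y_def Z_def B_def power2_eq_square)
    then show ?thesis by (subst forall_triple_iff_by_coincidence) simp
  qed
  also have "(\<forall>i j. i \<noteq> j \<longrightarrow> ?E i i j \<and> ?E i j j \<and> ?E i j i) \<longleftrightarrow>
    (\<forall>i j. i \<noteq> j \<longrightarrow>
       a i j * ((a i i)\<^sup>2 - a i j * a i i - b i j * c i j) = 0 \<and>
       a i j * ((a j j)\<^sup>2 - a i j * a j j - b i j * c i j) = 0 \<and>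
       a i j * c i j * d i j = 0 \<and>
       a i j * b i j * d i j = 0 \<and>
       a i j * d i j * (a i j - d i j) = 0)"
  proof (intro iff_allI imp_cong refl)
    fix i j :: 'n
    assume ij: "i \<noteq> j"
    then have B: "B i i = 0" "B j j = 0" "B i j = b i j" "B j i = c i j"
      by (simp_all add: B_def c)
    \<comment> \<open>The \<open>X\<close> coefficients give the first, second and fifth
      constraints; \<open>Y\<close> and \<open>Z\<close> give the two triple products.\<close>
    have "X i i j = a i j * ((a i i)\<^sup>2 - a i j * a i i - b i j * c i j)"
      "X i j j = - (a i j * ((a j j)\<^sup>2 - a i j * a j j - b i j * c i j))"
      "X i j i = a i j * d i j * (a i j - d i j)"
      unfolding X_def B d [OF ij] by algebra+
    moreover have "Y i i j = 0" "Y i j j = a i j * b i j * d i j" "Y i j i = a i j * b i j * d i j"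
      unfolding Y_def B d [OF ij] by algebra+
    moreover have "Z i i j = - (a i j * b i j * d i j)" "Z i j j = 0" "Z i j i = - (a i j * c i j * d i j)"
      unfolding Z_def B d [OF ij] by algebra+
    ultimately show "?E i i j \<and> ?E i j j \<and> ?E i j i \<longleftrightarrow>
       a i j * ((a i i)\<^sup>2 - a i j * a i i - b i j * c i j) = 0 \<and>
       a i j * ((a j j)\<^sup>2 - a i j * a j j - b i j * c i j) = 0 \<and>
       a i j * c i j * d i j = 0 \<and>
       a i j * b i j * d i j = 0 \<and>
       a i j * d i j * (a i j - d i j) = 0"
      by (simp only: neg_equal_0_iff_equal simp_thms) blast
  qed
  \<comment> \<open>Pairwise distinct triples are closed under permutation, so each conjunct may be
    reindexed separately. The choice makes \<open>B j i = c i j\<close> the prefactor of both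
    \<open>Z\<close> and \<open>Y\<close>.\<close>
  also have "(\<forall>i j k. i \<noteq> j \<and> i \<noteq> k \<and> j \<noteq> k \<longrightarrow> ?E i j k) \<longleftrightarrow>
    (\<forall>i j k. i \<noteq> j \<and> i \<noteq> k \<and> j \<noteq> k \<longrightarrow> Z k j i = 0 \<and> Y j i k = 0 \<and> X i k j = 0)"
    by metis
  also have "\<dots> \<longleftrightarrow>
    (\<forall>i j k. i \<noteq> j \<and> i \<noteq> k \<and> j \<noteq> k \<longrightarrow>
       c i j * (d i k * d j k - d i j * d j k - a i j * d i k) = 0 \<and>
       c i j * (- a i k * a j k + a i j * a j k + d i j * a i k) = 0 \<and>
       - a i k * (d j k)\<^sup>2 + (a i k)\<^sup>2 * d j k
         - a i j * b j k * c j k + a i j * b i k * c i k = 0)"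
  proof (intro iff_allI imp_cong refl)
    fix i j k :: 'n
    assume "i \<noteq> j \<and> i \<noteq> k \<and> j \<noteq> k"
    then have ijk: "i \<noteq> j" "i \<noteq> k" "j \<noteq> k" by simp_all
    then have B: "B j i = c i j" "B i k = b i k" "B k i = c i k" "B j k = b j k" "B k j = c j k"
      by (simp_all add: B_def c)
    have "Z k j i = c i j * (d i k * d j k - d i j * d j k - a i j * d i k)"
      unfolding Z_def B d [OF ijk(1)] d [OF ijk(2)] d [OF ijk(3)] by algebra
    moreover have "Y j i k = c i j * (- a i k * a j k + a i j * a j k + d i j * a i k)"
      unfolding Y_def B d [OF ijk(1)] by algebra
    moreover have "X i k j = - a i k * (d j k)\<^sup>2 + (a i k)\<^sup>2 * d j k
         - a i j * b j k * c j k + a i j * b i k * c i k"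
      unfolding X_def B d [OF ijk(3)] by algebra
    ultimately show "Z k j i = 0 \<and> Y j i k = 0 \<and> X i k j = 0 \<longleftrightarrow>
       c i j * (d i k * d j k - d i j * d j k - a i j * d i k) = 0 \<and>
       c i j * (- a i k * a j k + a i j * a j k + d i j * a i k) = 0 \<and>
       - a i k * (d j k)\<^sup>2 + (a i k)\<^sup>2 * d j k
         - a i j * b j k * c j k + a i j * b i k * c i k = 0"
      by simp
  qed
  finally show ?thesis .
qed

end
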